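(* Let $L>0$. (i) Let $c>0$, $F_1\in\mathbb R$, and suppose that $\psi$ is a smooth, $L$-periodic solution of $$\tfrac12(\psi')^2+U(\psi)=0,\qquad U(\psi)=\frac{\psi}{8c}\big(\psi^3-4c^2\psi-8cF_1\big).$$ Then the pair $$(u,v)=\Big(\psi(x-ct),\ \frac{\psi^2(x-ct)}{2c}\Big)$$ is a solution of the system $u_t+(uv)_x+u_{xxx}=0$, $v_t+uu_x=0$. (ii) In addition, there is a one-parameter family of such $L$-periodic functions, parametrized by $\kappa\in(0,1)$, which can be expressed as $$\psi(\xi)=\eta_4\,\frac{\mathrm{dn}^2\big(\frac{2K(\kappa)\xi}{L},\kappa\big)}{1+\beta^2\,\mathrm{sn}^2\big(\frac{2K(\kappa)\xi}{L},\kappa\big)},\qquad\psi(0)=\eta_4,$$ where $$h(\kappa)=4\sqrt{1-\kappa^2+\kappa^4},\qquad c=\frac{4K^2(\kappa)}{L^2}h(\kappa),$$ $$\eta_4=\frac{8\sqrt2K^2(\kappa)}{\sqrt3L^2}\sqrt{h(\kappa)\,[h(\kappa)+2(2\kappa^2-1)]},$$ $$\beta^2=2\kappa^2\,\frac{\sqrt{h(\kappa)+2(2\kappa^2-1)}}{\sqrt{h(\kappa)+2(2\kappa^2-1)}+\sqrt3\sqrt{h(\kappa)-2(2\kappa^2-1)}},\qquad F_1=-\frac{\eta_4}{8c}(4c^2-\eta_4^2).$$ That is, for each $\kappa\in(0,1)$ this $\psi$ is a smooth $L$-periodic solution of the equation in (i) with these values of $c$ and $F_1$.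
   Context: $\mathrm{sn},\mathrm{dn}$ are the Jacobi elliptic functions with modulus $\kappa$, and $K(\kappa)$ is the complete elliptic integral of the first kind with modulus $\kappa$. *)

theory Defs
  imports "HOL-Analysis.Analysis"
begin

definition elliptic_F :: "real \<Rightarrow> real \<Rightarrow> real" where
  "elliptic_F \<kappa> \<phi> = (LBINT \<theta>=ereal 0..ereal \<phi>. 1 / sqrt (1 - \<kappa>\<^sup>2 * (sin \<theta>)\<^sup>2))"

definition elliptic_K :: "real \<Rightarrow> real" where
  "elliptic_K \<kappa> = elliptic_F \<kappa> (pi / 2)"

text \<open>
  For a modulus \<open>\<bar>\<kappa>\<bar> < 1\<close> the function \<open>elliptic_F \<kappa>\<close> is an increasing bijection of the reals,
  so the description below is a proper one.
\<close>

definition jacobi_am :: "real \<Rightarrow> real \<Rightarrow> real" where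
  "jacobi_am u \<kappa> = (THE \<phi>. elliptic_F \<kappa> \<phi> = u)"

definition jacobi_sn :: "real \<Rightarrow> real \<Rightarrow> real" where
  "jacobi_sn u \<kappa> = sin (jacobi_am u \<kappa>)"

definition jacobi_dn :: "real \<Rightarrow> real \<Rightarrow> real" where
  "jacobi_dn u \<kappa> = sqrt (1 - \<kappa>\<^sup>2 * (jacobi_sn u \<kappa>)\<^sup>2)"

definition smooth_fun :: "(real \<Rightarrow> real) \<Rightarrow> bool" where
  "smooth_fun f \<longleftrightarrow> (\<forall>n x. (deriv ^^ n) f differentiable (at x))"

definition potential :: "real \<Rightarrow> real \<Rightarrow> real \<Rightarrow> real" where
  "potential c F\<^sub>1 y = y / (8 * c) * (y ^ 3 - 4 * c\<^sup>2 * y - 8 * c * F\<^sub>1)"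

definition periodic_profile :: "real \<Rightarrow> real \<Rightarrow> real \<Rightarrow> (real \<Rightarrow> real) \<Rightarrow> bool" where
  "periodic_profile L c F\<^sub>1 \<psi> \<longleftrightarrow>
     smooth_fun \<psi> \<and> (\<forall>\<xi>. \<psi> (\<xi> + L) = \<psi> \<xi>) \<and>
     (\<forall>\<xi>. 1 / 2 * (deriv \<psi> \<xi>)\<^sup>2 + potential c F\<^sub>1 (\<psi> \<xi>) = 0)"

text \<open>
  Classical solutions of \<open>u_t + (u v)_x + u_xxx = 0\<close>, \<open>v_t + u u_x = 0\<close> for all real \<open>x\<close> and \<open>t\<close>;
  the arguments of \<open>u\<close> and \<open>v\<close> are \<open>x\<close> and \<open>t\<close>, in this order. Since \<open>deriv\<close> is a total
  operator, the existence of every derivative that occurs is required separately.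
\<close>

definition solves_system :: "(real \<Rightarrow> real \<Rightarrow> real) \<Rightarrow> (real \<Rightarrow> real \<Rightarrow> real) \<Rightarrow> bool" where
  "solves_system u v \<longleftrightarrow> (\<forall>x t.
     (\<lambda>s. u x s) differentiable (at t) \<and>
     (\<lambda>s. v x s) differentiable (at t) \<and>
     (\<lambda>y. u y t * v y t) differentiable (at x) \<and>
     (\<forall>k<3. (deriv ^^ k) (\<lambda>y. u y t) differentiable (at x)) \<and>
     deriv (\<lambda>s. u x s) t + deriv (\<lambda>y. u y t * v y t) x + (deriv ^^ 3) (\<lambda>y. u y t) x = 0 \<and>
     deriv (\<lambda>s. v x s) t + u x t * deriv (\<lambda>y. u y t) x = 0)"

definition h_fun :: "real \<Rightarrow> real" where
  "h_fun \<kappa> = 4 * sqrt (1 - \<kappa>\<^sup>2 + \<kappa> ^ 4)"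

definition wave_speed :: "real \<Rightarrow> real \<Rightarrow> real" where
  "wave_speed L \<kappa> = 4 * (elliptic_K \<kappa>)\<^sup>2 / L\<^sup>2 * h_fun \<kappa>"

definition eta4 :: "real \<Rightarrow> real \<Rightarrow> real" where
  "eta4 L \<kappa> = 8 * sqrt 2 * (elliptic_K \<kappa>)\<^sup>2 / (sqrt 3 * L\<^sup>2) *
     sqrt (h_fun \<kappa> * (h_fun \<kappa> + 2 * (2 * \<kappa>\<^sup>2 - 1)))"

text \<open>\<open>beta_sq \<kappa>\<close> is the quantity \<open>\<beta>\<^sup>2\<close>, not \<open>\<beta>\<close>.\<close>

definition beta_sq :: "real \<Rightarrow> real" where
  "beta_sq \<kappa> = 2 * \<kappa>\<^sup>2 *
     (sqrt (h_fun \<kappa> + 2 * (2 * \<kappa>\<^sup>2 - 1)) /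
      (sqrt (h_fun \<kappa> + 2 * (2 * \<kappa>\<^sup>2 - 1)) + sqrt 3 * sqrt (h_fun \<kappa> - 2 * (2 * \<kappa>\<^sup>2 - 1))))"

definition F1_const :: "real \<Rightarrow> real \<Rightarrow> real" where
  "F1_const L \<kappa> =
     - (eta4 L \<kappa> / (8 * wave_speed L \<kappa>)) * (4 * (wave_speed L \<kappa>)\<^sup>2 - (eta4 L \<kappa>)\<^sup>2)"

definition dnoidal_profile :: "real \<Rightarrow> real \<Rightarrow> real \<Rightarrow> real" where
  "dnoidal_profile L \<kappa> \<xi> =
     eta4 L \<kappa> * ((jacobi_dn (2 * elliptic_K \<kappa> * \<xi> / L) \<kappa>)\<^sup>2 /
       (1 + beta_sq \<kappa> * (jacobi_sn (2 * elliptic_K \<kappa> * \<xi> / L) \<kappa>)\<^sup>2))"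

end

theory Submission
  imports Defs
begin

text \<open>
  Part (i): with \<open>W = \<psi>'' + U'(\<psi>)\<close>, differentiating the energy identity gives \<open>\<psi>' W = 0\<close>, and
  the travelling wave equation is \<open>W' = 0\<close>. Where \<open>\<psi>'\<close> vanishes one cannot divide; instead
  \<open>\<psi>' W' = 0\<close> is differentiated twice more, and \<open>W' = \<psi>'''\<close> at the zeros of \<open>\<psi>'\<close>.

  Part (ii): with \<open>k = \<kappa>\<^sup>2\<close> and \<open>r = sqrt (1 - k + k\<^sup>2)\<close> one has
  \<open>\<beta>\<^sup>2 = k - 1 + r\<close>. The profile is a fractional linear function of \<open>sn\<^sup>2\<close> which maps
  \<open>0, 1, 1/k, \<infinity>\<close> to the four roots of the quartic \<open>U\<close>, so that the energy identity becomes
  \<open>sn'\<^sup>2 = (1 - sn\<^sup>2) (1 - k sn\<^sup>2)\<close>.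
\<close>

section \<open>Smooth functions\<close>

lemma smooth_fun_has_deriv:
  assumes "smooth_fun f"
  shows "((deriv ^^ n) f has_real_derivative (deriv ^^ Suc n) f x) (at x)"
proof -
  have "(deriv ^^ n) f differentiable (at x)"
    using assms by (simp add: smooth_fun_def)
  then show ?thesis
    by (simp add: DERIV_deriv_iff_real_differentiable)
qed

text \<open>All iterated derivatives stay inside \<open>S\<close>, so no formula for the n-th
  derivative is ever needed.\<close>

lemma smooth_fun_if_derivation_closed:
  assumes "f \<in> S"
    and closed: "\<And>g. g \<in> S \<Longrightarrow> \<exists>g'\<in>S. \<forall>x. (g has_real_derivative g' x) (at x)"
  shows "smooth_fun f"
proof -
  have mem: "(deriv ^^ n) f \<in> S" for n
  proof (induction n)
    case (Suc n)
    obtain g' where g': "g' \<in> S" "\<And>x. ((deriv ^^ n) f has_real_derivative g' x) (at x)"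
      using closed[OF Suc] by blast
    have "deriv ((deriv ^^ n) f) = g'"
      using g'(2) by (auto intro: DERIV_imp_deriv)
    then show ?case using g'(1) by simp
  qed (use assms(1) in simp)
  show ?thesis
    unfolding smooth_fun_def real_differentiable_def using closed[OF mem] by blast
qed

inductive_set function_algebra :: "(real \<Rightarrow> real) set \<Rightarrow> (real \<Rightarrow> real) set"
  for G :: "(real \<Rightarrow> real) set" where
  gen: "g \<in> G \<Longrightarrow> g \<in> function_algebra G"
| const: "(\<lambda>x. a) \<in> function_algebra G"
| add: "\<lbrakk>f \<in> function_algebra G; g \<in> function_algebra G\<rbrakk> \<Longrightarrow> (\<lambda>x. f x + g x) \<in> function_algebra G"
| mult: "\<lbrakk>f \<in> function_algebra G; g \<in> function_algebra G\<rbrakk> \<Longrightarrow> (\<lambda>x. f x * g x) \<in> function_algebra G"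

text \<open>By the sum and product rules, a polynomial algebra is closed under differentiation as
  soon as the derivatives of its generators lie in it.\<close>

lemma smooth_fun_function_algebra:
  assumes "f \<in> function_algebra G"
    and gens: "\<And>g. g \<in> G \<Longrightarrow> \<exists>g'\<in>function_algebra G. \<forall>x. (g has_real_derivative g' x) (at x)"
  shows "smooth_fun f"
proof (rule smooth_fun_if_derivation_closed[OF assms(1)])
  fix g assume "g \<in> function_algebra G"
  then show "\<exists>g'\<in>function_algebra G. \<forall>x. (g has_real_derivative g' x) (at x)"
  proof induction
    case (gen g)
    then show ?case by (rule gens)
  next
    case (const a)
    show ?case
      by (rule bexI[of _ "\<lambda>x. 0"]) (auto intro: function_algebra.const)
  next
    case (add f g)
    then obtain f' g' where "f' \<in> function_algebra G" "g' \<in> function_algebra G"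
      "\<And>x. (f has_real_derivative f' x) (at x)" "\<And>x. (g has_real_derivative g' x) (at x)"
      by blast
    then show ?case
      by (intro bexI[of _ "\<lambda>x. f' x + g' x"])
        (auto intro: function_algebra.add DERIV_add)
  next
    case (mult f g)
    then obtain f' g' where "f' \<in> function_algebra G" "g' \<in> function_algebra G"
      "\<And>x. (f has_real_derivative f' x) (at x)" "\<And>x. (g has_real_derivative g' x) (at x)"
      by blast
    then show ?case using mult.hyps
      by (intro bexI[of _ "\<lambda>x. f' x * g x + g' x * f x"])
        (auto intro!: function_algebra.add function_algebra.mult DERIV_mult)
  qed
qed

section \<open>Travelling waves\<close>

lemma has_real_derivative_zero_fun:
  assumes "\<And>x. f x = (0::real)" and "(f has_real_derivative d) (at x)"
  shows "d = 0"
proof -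
  have "f = (\<lambda>x. 0)" using assms(1) by auto
  then show ?thesis using assms(2) DERIV_const DERIV_unique by metis
qed

text \<open>This is the first equation of the system after inserting the travelling wave:
  \<open>u * v\<close> becomes \<open>\<psi> ^ 3 / (2 * c)\<close>, and the time derivative
  contributes \<open>- c * deriv \<psi>\<close>.\<close>

lemma periodic_profile_third_derivative:
  assumes "c > 0" and "periodic_profile L c F\<^sub>1 \<psi>"
  shows "(deriv ^^ 3) \<psi> x + (3 * (\<psi> x)\<^sup>2 / (2 * c) - c) * deriv \<psi> x = 0"
proof -
  define p where "p n = (deriv ^^ n) \<psi>" for n
  have sm: "smooth_fun \<psi>" using assms(2) by (simp add: periodic_profile_def)
  have p: "(p n has_real_derivative p (Suc n) x) (at x)" for n x
    unfolding p_def by (rule smooth_fun_has_deriv[OF sm])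
  have p': "(p n has_real_derivative p m x) (at x)" if "m = Suc n" for n m x
    using p that by simp
  have p_deriv: "(p 0 has_real_derivative p 1 x) (at x)" "(p 1 has_real_derivative p 2 x) (at x)"
    "(p 2 has_real_derivative p 3 x) (at x)" "(p 3 has_real_derivative p 4 x) (at x)"
    "(p 4 has_real_derivative p 5 x) (at x)" for x
    by (rule p'; simp)+
  note [derivative_intros] = p_deriv[THEN DERIV_chain2]
  \<comment> \<open>The bracket in \<open>W\<close> is the derivative of the potential.
    \<open>V\<close>, \<open>V1\<close>, \<open>V2\<close> are the successive derivatives of
    \<open>W\<close>, and the claim is \<open>V x = 0\<close>.\<close>
  define W where "W x = p 2 x + ((p 0 x)^3 / (2*c) - c * p 0 x - F\<^sub>1)" for x
  define V where "V x = p 3 x + (3 * (p 0 x)\<^sup>2 / (2 * c) - c) * p 1 x" for x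
  define V1 where "V1 x = p 4 x + (3 * (p 0 x)\<^sup>2 / (2 * c) - c) * p 2 x
      + 3 * p 0 x * p 1 x / c * p 1 x" for x
  define V2 where "V2 x = p 5 x + (3 * (p 0 x)\<^sup>2 / (2 * c) - c) * p 3 x
      + 9 * p 0 x * p 1 x * p 2 x / c + 3 * (p 1 x)^3 / c" for x
  have W: "(W has_real_derivative V x) (at x)" for x
    unfolding W_def V_def using assms(1)
    by (auto intro!: derivative_eq_intros simp: field_simps power2_eq_square simp del: One_nat_def)
  have V: "(V has_real_derivative V1 x) (at x)" for x
    unfolding V1_def V_def using assms(1)
    by (auto intro!: derivative_eq_intros simp: field_simps power2_eq_square simp del: One_nat_def)
  have V1: "(V1 has_real_derivative V2 x) (at x)" for x
    unfolding V1_def V2_def using assms(1)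
    by (auto intro!: derivative_eq_intros simp: field_simps power2_eq_square power3_eq_cube simp del: One_nat_def)
  have "1/2 * (p 1 x)\<^sup>2 + potential c F\<^sub>1 (p 0 x) = 0" for x
    using assms(2) by (simp add: periodic_profile_def p_def)
  moreover have "((\<lambda>x. 1/2 * (p 1 x)\<^sup>2 + potential c F\<^sub>1 (p 0 x))
      has_real_derivative p 1 x * W x) (at x)" for x
    unfolding potential_def W_def using assms(1)
    by (auto intro!: derivative_eq_intros simp: field_simps power2_eq_square power3_eq_cube simp del: One_nat_def)
  ultimately have pW: "p 1 x * W x = 0" for x
    by (rule has_real_derivative_zero_fun)
  have "((\<lambda>x. p 1 x * W x) has_real_derivative p 2 x * W x + V x * p 1 x) (at x)" for x
    by (rule DERIV_mult[OF p' W]) simp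
  then have pW1: "p 2 x * W x + V x * p 1 x = 0" for x
    by (rule has_real_derivative_zero_fun[OF pW])
  \<comment> \<open>If \<open>p 1 x\<close> is nonzero, then \<open>pW\<close> forces
    \<open>W x = 0\<close>, and the first term of \<open>pW1\<close> drops out.\<close>
  have pV: "p 1 x * V x = 0" for x
    using pW[of x] pW1[of x] by (cases "p 1 x = 0") auto
  have "((\<lambda>x. p 1 x * V x) has_real_derivative p 2 x * V x + V1 x * p 1 x) (at x)" for x
    by (rule DERIV_mult[OF p' V]) simp
  then have pV1: "p 2 x * V x + V1 x * p 1 x = 0" for x
    by (rule has_real_derivative_zero_fun[OF pV])
  have "((\<lambda>x. p 2 x * V x + V1 x * p 1 x) has_real_derivative
      (p 3 x * V x + V1 x * p 2 x) + (V2 x * p 1 x + p 2 x * V1 x)) (at x)" for x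
    by (intro DERIV_add DERIV_mult p' V V1) auto
  then have pV2: "(p 3 x * V x + V1 x * p 2 x) + (V2 x * p 1 x + p 2 x * V1 x) = 0" for x
    by (rule has_real_derivative_zero_fun[OF pV1])
  \<comment> \<open>If the first derivative is nonzero at x, \<open>pV\<close> suffices. If it
    vanishes but the second does not, \<open>pV1\<close> does. If both vanish, \<open>V\<close>
    equals the third derivative there, and \<open>pV2\<close> reduces to the square of that value
    being zero.\<close>
  have "V x = 0"
  proof (cases "p 1 x = 0 \<and> p 2 x = 0")
    case True
    then have "p 3 x * V x = 0" using pV2[of x] by simp
    moreover have "V x = p 3 x" using True by (simp add: V_def)
    ultimately show ?thesis by simp
  next
    case False
    then show ?thesis using pV[of x] pV1[of x] by auto
  qed
  then show ?thesis by (simp add: V_def p_def)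
qed

lemma deriv_funpow_shift:
  assumes "smooth_fun f"
  shows "(deriv ^^ n) (\<lambda>y. f (y - a)) = (\<lambda>y. (deriv ^^ n) f (y - a))"
proof (induction n)
  case (Suc n)
  have "deriv (\<lambda>y. (deriv ^^ n) f (y - a)) x = (deriv ^^ Suc n) f (x - a)" for x
    using DERIV_shift[of "(deriv ^^ n) f" _ x "- a"] smooth_fun_has_deriv[OF assms, of n "x - a"]
    by (intro DERIV_imp_deriv) simp
  then show ?case using Suc by auto
qed simp

text \<open>The second equation is just the chain rule for \<open>v = u\<^sup>2 / (2 * c)\<close>;
  only the first one draws on the profile equation, through its third-derivative form.\<close>

lemma periodic_profile_solves_system:
  assumes "c > 0" and "periodic_profile L c F\<^sub>1 \<psi>"
  shows "solves_system (\<lambda>x t. \<psi> (x - c * t)) (\<lambda>x t. (\<psi> (x - c * t))\<^sup>2 / (2 * c))"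
proof -
  have sm: "smooth_fun \<psi>" using assms(2) by (simp add: periodic_profile_def)
  have d0: "(\<psi> has_real_derivative deriv \<psi> x) (at x)" for x
    using smooth_fun_has_deriv[OF sm, of 0] by simp
  note [derivative_intros] = d0[THEN DERIV_chain2]
  show ?thesis
    unfolding solves_system_def
  proof (intro allI, goal_cases)
    case (1 x t)
    let ?z = "x - c * t"
    have u_t: "((\<lambda>s. \<psi> (x - c * s)) has_real_derivative - c * deriv \<psi> ?z) (at t)"
      by (auto intro!: derivative_eq_intros)
    have v_t: "((\<lambda>s. (\<psi> (x - c * s))\<^sup>2 / (2 * c)) has_real_derivative
        - \<psi> ?z * deriv \<psi> ?z) (at t)"
      using assms(1) by (auto intro!: derivative_eq_intros)
    have uv_x: "((\<lambda>y. \<psi> (y - c * t) * ((\<psi> (y - c * t))\<^sup>2 / (2 * c))) has_real_derivative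
        3 * (\<psi> ?z)\<^sup>2 / (2 * c) * deriv \<psi> ?z) (at x)"
      using assms(1)
      by (auto intro!: derivative_eq_intros simp: field_simps power2_eq_square)
    have u_x: "((deriv ^^ n) (\<lambda>y. \<psi> (y - c * t)) has_real_derivative
        (deriv ^^ Suc n) \<psi> ?z) (at x)" for n
      using DERIV_shift[of "(deriv ^^ n) \<psi>" _ x "- (c * t)"] smooth_fun_has_deriv[OF sm, of n ?z]
      unfolding deriv_funpow_shift[OF sm] by simp
    have "deriv (\<lambda>y. \<psi> (y - c * t)) x = deriv \<psi> ?z"
      using DERIV_imp_deriv[OF u_x[of 0]] by simp
    moreover have "(deriv ^^ 3) (\<lambda>y. \<psi> (y - c * t)) x = (deriv ^^ 3) \<psi> ?z"
      by (simp only: deriv_funpow_shift[OF sm])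
    moreover have "(deriv ^^ 3) \<psi> ?z + (3 * (\<psi> ?z)\<^sup>2 / (2 * c) - c) * deriv \<psi> ?z = 0"
      by (rule periodic_profile_third_derivative[OF assms])
    ultimately show ?case
      unfolding DERIV_imp_deriv[OF u_t] DERIV_imp_deriv[OF v_t] DERIV_imp_deriv[OF uv_x]
      using u_t v_t uv_x u_x by (auto simp: real_differentiable_def algebra_simps)
  qed
qed

section \<open>Jacobi elliptic functions\<close>

text \<open>An auxiliary function that makes the derivatives of sn and dn polynomial. Going through
  the amplitude gives it the correct sign, which a square root of \<open>1 - sn^2\<close> would
  lose.\<close>

definition jacobi_cn :: "real \<Rightarrow> real \<Rightarrow> real" where
  "jacobi_cn u \<kappa> = cos (jacobi_am u \<kappa>)"

context
  fixes \<kappa> :: real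
  assumes \<kappa>: "0 < \<kappa>" "\<kappa> < 1"
begin

section \<open>The incomplete elliptic integral: bijectivity, oddness and quasi-periodicity\<close>

lemma elliptic_radicand_pos: "0 < 1 - \<kappa>\<^sup>2 * (sin \<theta>)\<^sup>2"
proof -
  have "\<kappa>\<^sup>2 < 1" using \<kappa> by (simp add: power_less_one_iff)
  moreover have "\<kappa>\<^sup>2 * (sin \<theta>)\<^sup>2 \<le> \<kappa>\<^sup>2 * 1"
    by (intro mult_left_mono) (auto simp: abs_square_le_1)
  ultimately show ?thesis by linarith
qed

lemma elliptic_F_has_deriv:
  "(elliptic_F \<kappa> has_real_derivative 1 / sqrt (1 - \<kappa>\<^sup>2 * (sin \<phi>)\<^sup>2)) (at \<phi>)"
proof -
  let ?f = "\<lambda>\<theta>. 1 / sqrt (1 - \<kappa>\<^sup>2 * (sin \<theta>)\<^sup>2)"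
  \<comment> \<open>Both the base point 0 and \<open>\<phi>\<close>, of either sign, are interior to
    this interval, so the one-sided restriction on the derivative disappears.\<close>
  let ?a = "- \<bar>\<phi>\<bar> - 1" and ?b = "\<bar>\<phi>\<bar> + 1"
  have "sqrt (1 - \<kappa>\<^sup>2 * (sin \<theta>)\<^sup>2) \<noteq> 0" for \<theta>
    using elliptic_radicand_pos[of \<theta>] by simp
  then have "continuous_on {?a..?b} ?f"
    by (auto intro!: continuous_intros)
  then have "((\<lambda>u. LBINT y=ereal 0..ereal u. ?f y) has_vector_derivative ?f \<phi>)
      (at \<phi> within {?a..?b})"
    by (intro interval_integral_FTC2) auto
  moreover have "at \<phi> within {?a..?b} = at \<phi>"
    by (rule at_within_interior) auto
  ultimately show ?thesis
    unfolding elliptic_F_def has_real_derivative_iff_has_vector_derivative by simp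
qed

lemma elliptic_F_zero: "elliptic_F \<kappa> 0 = 0"
  by (simp add: elliptic_F_def)

text \<open>The integrand is at least 1. This single bound yields injectivity, unboundedness in both
  directions (hence surjectivity), and the positivity of K.\<close>

lemma elliptic_F_diff_ge:
  assumes "a \<le> b"
  shows "b - a \<le> elliptic_F \<kappa> b - elliptic_F \<kappa> a"
proof -
  have "elliptic_F \<kappa> a - a \<le> elliptic_F \<kappa> b - b"
  proof (rule DERIV_nonneg_imp_nondecreasing[OF assms])
    fix x
    have "sqrt (1 - \<kappa>\<^sup>2 * (sin x)\<^sup>2) \<le> 1" by simp
    then have "0 \<le> 1 / sqrt (1 - \<kappa>\<^sup>2 * (sin x)\<^sup>2) - 1"
      using elliptic_radicand_pos[of x] by (simp add: field_simps)
    moreover have "((\<lambda>a. elliptic_F \<kappa> a - a) has_real_derivative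
        1 / sqrt (1 - \<kappa>\<^sup>2 * (sin x)\<^sup>2) - 1) (at x)"
      by (rule DERIV_diff[OF elliptic_F_has_deriv DERIV_ident])
    ultimately show "\<exists>y. ((\<lambda>a. elliptic_F \<kappa> a - a) has_real_derivative y) (at x) \<and> 0 \<le> y"
      by blast
  qed
  then show ?thesis by simp
qed

lemma elliptic_F_inj: "elliptic_F \<kappa> a = elliptic_F \<kappa> b \<Longrightarrow> a = b"
  using elliptic_F_diff_ge[of a b] elliptic_F_diff_ge[of b a] by linarith

lemma elliptic_F_surj: "\<exists>\<phi>. elliptic_F \<kappa> \<phi> = u"
proof -
  have "\<exists>x\<ge>-\<bar>u\<bar>. x \<le> \<bar>u\<bar> \<and> elliptic_F \<kappa> x = u"
  proof (rule IVT)
    show "elliptic_F \<kappa> (- \<bar>u\<bar>) \<le> u" "u \<le> elliptic_F \<kappa> \<bar>u\<bar>"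
      using elliptic_F_diff_ge[of "-\<bar>u\<bar>" 0] elliptic_F_diff_ge[of 0 "\<bar>u\<bar>"]
      by (auto simp: elliptic_F_zero)
    show "\<forall>x. - \<bar>u\<bar> \<le> x \<and> x \<le> \<bar>u\<bar> \<longrightarrow> isCont (elliptic_F \<kappa>) x"
      using elliptic_F_has_deriv DERIV_isCont by blast
  qed auto
  then show ?thesis by blast
qed

lemma elliptic_F_am: "elliptic_F \<kappa> (jacobi_am u \<kappa>) = u"
proof -
  have "\<exists>!\<phi>. elliptic_F \<kappa> \<phi> = u"
    using elliptic_F_surj elliptic_F_inj by metis
  then show ?thesis
    unfolding jacobi_am_def by (rule theI')
qed

lemma jacobi_am_eqI: "elliptic_F \<kappa> \<phi> = u \<Longrightarrow> jacobi_am u \<kappa> = \<phi>"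
  using elliptic_F_am elliptic_F_inj by metis

lemma elliptic_F_minus: "elliptic_F \<kappa> (- \<phi>) = - elliptic_F \<kappa> \<phi>"
proof -
  have "((\<lambda>\<phi>. elliptic_F \<kappa> (- \<phi>) + elliptic_F \<kappa> \<phi>) has_real_derivative 0) (at x)" for x
    by (auto intro!: derivative_eq_intros elliptic_F_has_deriv[THEN DERIV_chain2]
        elliptic_F_has_deriv)
  then have "elliptic_F \<kappa> (- \<phi>) + elliptic_F \<kappa> \<phi> = elliptic_F \<kappa> (- 0) + elliptic_F \<kappa> 0"
    by (rule DERIV_isconst_all[rule_format, of "\<lambda>\<phi>. elliptic_F \<kappa> (- \<phi>) + elliptic_F \<kappa> \<phi>"])
  then show ?thesis by (simp add: elliptic_F_zero)
qed

lemma elliptic_F_plus_pi: "elliptic_F \<kappa> (\<phi> + pi) = elliptic_F \<kappa> \<phi> + 2 * elliptic_K \<kappa>"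
proof -
  have "((\<lambda>\<phi>. elliptic_F \<kappa> (\<phi> + pi) - elliptic_F \<kappa> \<phi>) has_real_derivative 0) (at x)" for x
    by (auto intro!: derivative_eq_intros elliptic_F_has_deriv[THEN DERIV_chain2]
        elliptic_F_has_deriv)
  \<comment> \<open>The integrand has period pi, so the difference is constant. It is evaluated at
    \<open>- (pi/2)\<close>, where oddness turns it into twice K.\<close>
  then have "elliptic_F \<kappa> (\<phi> + pi) - elliptic_F \<kappa> \<phi>
      = elliptic_F \<kappa> (- (pi/2) + pi) - elliptic_F \<kappa> (- (pi/2))"
    by (rule DERIV_isconst_all[rule_format, of "\<lambda>\<phi>. elliptic_F \<kappa> (\<phi> + pi) - elliptic_F \<kappa> \<phi>"])
  then show ?thesis by (simp add: elliptic_F_minus elliptic_K_def)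
qed

lemma elliptic_K_pos: "0 < elliptic_K \<kappa>"
  using elliptic_F_diff_ge[of 0 "pi/2"] pi_gt_zero unfolding elliptic_K_def elliptic_F_zero
  by linarith

section \<open>The amplitude and the derivatives of sn, cn and dn\<close>

lemma jacobi_am_zero: "jacobi_am 0 \<kappa> = 0"
  by (rule jacobi_am_eqI) (rule elliptic_F_zero)

lemma jacobi_am_plus_2K: "jacobi_am (u + 2 * elliptic_K \<kappa>) \<kappa> = jacobi_am u \<kappa> + pi"
  by (rule jacobi_am_eqI) (simp add: elliptic_F_plus_pi elliptic_F_am)

text \<open>Inverse function rule: the integrand of \<open>elliptic_F\<close> at the amplitude is
  the reciprocal of dn.\<close>

lemma jacobi_am_has_deriv:
  "((\<lambda>u. jacobi_am u \<kappa>) has_real_derivative jacobi_dn u \<kappa>) (at u)"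
proof -
  let ?g = "\<lambda>u. jacobi_am u \<kappa>"
  have "(elliptic_F \<kappa> has_real_derivative 1 / jacobi_dn u \<kappa>) (at (?g u))"
    using elliptic_F_has_deriv[of "?g u"] by (simp add: jacobi_dn_def jacobi_sn_def)
  moreover have dn: "jacobi_dn u \<kappa> \<noteq> 0"
    using elliptic_radicand_pos[of "?g u"] by (simp add: jacobi_dn_def jacobi_sn_def)
  moreover have "isCont ?g u"
  proof -
    have "isCont ?g (elliptic_F \<kappa> (?g u))"
      by (rule isCont_inverse_function[of 1])
        (auto simp: jacobi_am_eqI intro: DERIV_isCont[OF elliptic_F_has_deriv])
    then show ?thesis by (simp add: elliptic_F_am)
  qed
  ultimately have "(?g has_real_derivative inverse (1 / jacobi_dn u \<kappa>)) (at u)"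
    by (intro DERIV_inverse_function[of "elliptic_F \<kappa>" _ ?g u "u - 1" "u + 1"])
      (auto simp: elliptic_F_am)
  then show ?thesis by simp
qed

lemma jacobi_sn_has_deriv:
  "((\<lambda>u. jacobi_sn u \<kappa>) has_real_derivative jacobi_cn u \<kappa> * jacobi_dn u \<kappa>) (at u)"
  unfolding jacobi_sn_def jacobi_cn_def
  by (auto intro!: derivative_eq_intros jacobi_am_has_deriv)

lemma jacobi_cn_has_deriv:
  "((\<lambda>u. jacobi_cn u \<kappa>) has_real_derivative - jacobi_sn u \<kappa> * jacobi_dn u \<kappa>) (at u)"
  unfolding jacobi_sn_def jacobi_cn_def
  by (auto intro!: derivative_eq_intros jacobi_am_has_deriv)

lemma jacobi_dn_pos: "0 < jacobi_dn u \<kappa>"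
  using elliptic_radicand_pos by (simp add: jacobi_dn_def jacobi_sn_def)

lemma jacobi_dn_sq: "(jacobi_dn u \<kappa>)\<^sup>2 = 1 - \<kappa>\<^sup>2 * (jacobi_sn u \<kappa>)\<^sup>2"
  using elliptic_radicand_pos[of "jacobi_am u \<kappa>"] by (simp add: jacobi_dn_def jacobi_sn_def)

lemma jacobi_cn_sq: "(jacobi_cn u \<kappa>)\<^sup>2 = 1 - (jacobi_sn u \<kappa>)\<^sup>2"
  by (simp add: jacobi_cn_def jacobi_sn_def cos_squared_eq)

lemma jacobi_dn_has_deriv:
  "((\<lambda>u. jacobi_dn u \<kappa>) has_real_derivative - \<kappa>\<^sup>2 * (jacobi_sn u \<kappa> * jacobi_cn u \<kappa>)) (at u)"
proof -
  have "((\<lambda>u. 1 - \<kappa>\<^sup>2 * (jacobi_sn u \<kappa>)\<^sup>2) has_real_derivative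
      - \<kappa>\<^sup>2 * (2 * jacobi_sn u \<kappa> * (jacobi_cn u \<kappa> * jacobi_dn u \<kappa>))) (at u)"
    by (auto intro!: derivative_eq_intros jacobi_sn_has_deriv)
  moreover have "(sqrt has_real_derivative inverse (jacobi_dn u \<kappa>) / 2)
      (at (1 - \<kappa>\<^sup>2 * (jacobi_sn u \<kappa>)\<^sup>2))"
    unfolding jacobi_dn_def
    by (rule DERIV_real_sqrt) (simp only: jacobi_sn_def elliptic_radicand_pos)
  ultimately have "((\<lambda>u. jacobi_dn u \<kappa>) has_real_derivative inverse (jacobi_dn u \<kappa>) / 2 *
      (- \<kappa>\<^sup>2 * (2 * jacobi_sn u \<kappa> * (jacobi_cn u \<kappa> * jacobi_dn u \<kappa>)))) (at u)"
    unfolding jacobi_dn_def[of _ \<kappa>, abs_def] by (rule DERIV_chain2[rotated])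
  then show ?thesis
    using jacobi_dn_pos[of u] by (simp add: field_simps)
qed

text \<open>The amplitude gains pi, so sn itself changes sign; only its square has period 2K. This
  is the source of the period L of the profile.\<close>

lemma jacobi_sn_sq_plus_2K:
  "(jacobi_sn (u + 2 * elliptic_K \<kappa>) \<kappa>)\<^sup>2 = (jacobi_sn u \<kappa>)\<^sup>2"
  by (simp add: jacobi_sn_def jacobi_am_plus_2K)

end

section \<open>The dnoidal family\<close>

text \<open>The squares of \<open>h_fun \<kappa>\<close> and of
  \<open>2 * (2 * \<kappa>\<^sup>2 - 1)\<close> differ by exactly 12, so h dominates in absolute
  value.\<close>

lemma h_fun_pm_pos:
  "0 < h_fun \<kappa> + 2 * (2 * \<kappa>\<^sup>2 - 1)" "0 < h_fun \<kappa> - 2 * (2 * \<kappa>\<^sup>2 - 1)"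
proof -
  have "(2 * (2 * \<kappa>\<^sup>2 - 1))\<^sup>2 < 16 * (1 - \<kappa>\<^sup>2 + \<kappa> ^ 4)"
    by (simp add: power2_eq_square power4_eq_xxxx algebra_simps)
  then have "\<bar>2 * (2 * \<kappa>\<^sup>2 - 1)\<bar> < sqrt (16 * (1 - \<kappa>\<^sup>2 + \<kappa> ^ 4))"
    by (intro real_less_rsqrt) simp
  also have "\<dots> = h_fun \<kappa>"
    unfolding h_fun_def real_sqrt_mult by simp
  finally show "0 < h_fun \<kappa> + 2 * (2 * \<kappa>\<^sup>2 - 1)" "0 < h_fun \<kappa> - 2 * (2 * \<kappa>\<^sup>2 - 1)"
    by linarith+
qed

lemma h_fun_sq: "(h_fun \<kappa>)\<^sup>2 = 16 * (1 - \<kappa>\<^sup>2 + \<kappa> ^ 4)"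
proof -
  have "1 - \<kappa>\<^sup>2 + \<kappa> ^ 4 = (\<kappa>\<^sup>2 - 1/2)\<^sup>2 + 3/4"
    by (simp add: power2_eq_square power4_eq_xxxx algebra_simps)
  then have "0 \<le> 1 - \<kappa>\<^sup>2 + \<kappa> ^ 4" by simp
  then show ?thesis by (simp add: h_fun_def power_mult_distrib)
qed

text \<open>The nested radicals collapse because the two radicands \<open>P\<close> and
  \<open>Q\<close> have product 12.\<close>

lemma beta_sq_eq: "beta_sq \<kappa> = \<kappa>\<^sup>2 - 1 + h_fun \<kappa> / 4"
proof -
  define P where "P = h_fun \<kappa> + 2 * (2 * \<kappa>\<^sup>2 - 1)"
  define Q where "Q = h_fun \<kappa> - 2 * (2 * \<kappa>\<^sup>2 - 1)"
  have P: "P > 0" and Q: "Q > 0" unfolding P_def Q_def by (rule h_fun_pm_pos)+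
  have "P * Q = (h_fun \<kappa>)\<^sup>2 - (2 * (2 * \<kappa>\<^sup>2 - 1))\<^sup>2"
    unfolding P_def Q_def by (simp add: power2_eq_square algebra_simps)
  then have PQ: "P * (3 * Q) = 6\<^sup>2"
    unfolding h_fun_sq by (simp add: power2_eq_square power4_eq_xxxx algebra_simps)
  have "sqrt P * (sqrt 3 * sqrt Q) = sqrt (P * (3 * Q))"
    by (simp add: real_sqrt_mult)
  also have "\<dots> = 6" unfolding PQ by simp
  finally have *: "sqrt P * (sqrt 3 * sqrt Q) = 6" .
  \<comment> \<open>Extending the fraction by \<open>sqrt P\<close> turns the mixed product in the
    denominator into 6 and removes all roots.\<close>
  have "sqrt P / (sqrt P + sqrt 3 * sqrt Q)
      = (sqrt P * sqrt P) / (sqrt P * sqrt P + sqrt P * (sqrt 3 * sqrt Q))"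
    using P unfolding distrib_left[symmetric] by (intro mult_divide_mult_cancel_left[symmetric]) simp
  also have "\<dots> = P / (P + 6)" unfolding * using P by simp
  finally have "beta_sq \<kappa> = 2 * \<kappa>\<^sup>2 * (P / (P + 6))"
    unfolding beta_sq_def P_def Q_def by simp
  also have "\<dots> = \<kappa>\<^sup>2 - 1 + h_fun \<kappa> / 4"
  proof -
    have "2 * \<kappa>\<^sup>2 * P = (\<kappa>\<^sup>2 - 1 + h_fun \<kappa> / 4) * (P + 6)"
      using h_fun_sq[of \<kappa>] unfolding P_def
      by (simp add: power2_eq_square power4_eq_xxxx algebra_simps)
    then show ?thesis using P by (simp add: field_simps)
  qed
  finally show ?thesis .
qed

lemma beta_sq_pos:
  assumes "0 < \<kappa>"
  shows "0 < beta_sq \<kappa>"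
proof -
  have "0 < sqrt (h_fun \<kappa> + 2 * (2 * \<kappa>\<^sup>2 - 1)) + sqrt 3 * sqrt (h_fun \<kappa> - 2 * (2 * \<kappa>\<^sup>2 - 1))"
    using h_fun_pm_pos by (intro add_pos_pos mult_pos_pos) auto
  then show ?thesis
    unfolding beta_sq_def using assms h_fun_pm_pos by (intro mult_pos_pos divide_pos_pos) auto
qed

text \<open>The equation for \<open>\<beta>\<^sup>2\<close> which makes the root \<open>-\<kappa>\<^sup>2 \<eta>\<^sub>4 / \<beta>\<^sup>2\<close> of the quartic the
  image of \<open>sn\<^sup>2 = \<infinity>\<close>.\<close>

lemma beta_sq_quadratic: "(beta_sq \<kappa>)\<^sup>2 + 2 * beta_sq \<kappa> - 2 * \<kappa>\<^sup>2 * beta_sq \<kappa> - \<kappa>\<^sup>2 = 0"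
  using h_fun_sq[of \<kappa>] unfolding beta_sq_eq
  by (simp add: power2_eq_square power4_eq_xxxx algebra_simps)

lemma eta4_sq:
  "(eta4 L \<kappa>)\<^sup>2 = 8 / 3 * ((2 * elliptic_K \<kappa> / L)\<^sup>2)\<^sup>2 * h_fun \<kappa> * (h_fun \<kappa> + 2 * (2 * \<kappa>\<^sup>2 - 1))"
proof -
  have "0 \<le> h_fun \<kappa> * (h_fun \<kappa> + 2 * (2 * \<kappa>\<^sup>2 - 1))"
    using h_fun_pm_pos[of \<kappa>] by (intro mult_nonneg_nonneg) linarith+
  then show ?thesis
    unfolding eta4_def
    by (simp add: power_mult_distrib power_divide)
qed

text \<open>The two parameter relations, with \<open>\<beta>\<^sup>2\<close> eliminating \<open>h\<close>: matching the leading
  coefficient and matching the product of the two remaining roots of the quartic.\<close>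

lemma eta4_wave_speed_relations:
  shows "16 * (2 * elliptic_K \<kappa> / L)\<^sup>2 * wave_speed L \<kappa> * (beta_sq \<kappa> * (1 + beta_sq \<kappa>))
      = (eta4 L \<kappa>)\<^sup>2 * (beta_sq \<kappa> + \<kappa>\<^sup>2)"
    and "(4 * (wave_speed L \<kappa>)\<^sup>2 - (eta4 L \<kappa>)\<^sup>2) * (beta_sq \<kappa> * (1 + beta_sq \<kappa>))
      = (eta4 L \<kappa>)\<^sup>2 * (\<kappa>\<^sup>2 * (1 - \<kappa>\<^sup>2))"
proof -
  define b where "b = beta_sq \<kappa>"
  define a where "a = (2 * elliptic_K \<kappa> / L)\<^sup>2"
  define k where "k = \<kappa>\<^sup>2"
  have h: "h_fun \<kappa> = 4 * (b + 1 - k)" using beta_sq_eq[of \<kappa>] by (simp add: b_def k_def)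
  have q: "b * b = 2 * k * b + k - 2 * b"
    using beta_sq_quadratic[of \<kappa>] by (simp add: b_def k_def power2_eq_square)
  have c: "wave_speed L \<kappa> = a * (4 * (b + 1 - k))"
    unfolding wave_speed_def h a_def by (simp add: power_divide power_mult_distrib)
  \<comment> \<open>By \<open>h\<close>, the factor
    \<open>h_fun \<kappa> + 2 * (2 * \<kappa>\<^sup>2 - 1)\<close> equals
    \<open>4 * b + 2\<close>.\<close>
  have e: "(eta4 L \<kappa>)\<^sup>2 = 8 / 3 * a\<^sup>2 * (4 * (b + 1 - k)) * (4 * b + 2)"
    unfolding eta4_sq h a_def k_def by (simp add: algebra_simps)
  have 1: "16 * a * (a * (4 * (b + 1 - k))) * (b * (1 + b))
      = 8 / 3 * a\<^sup>2 * (4 * (b + 1 - k)) * (4 * b + 2) * (b + k)"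
  proof -
    \<comment> \<open>What remains after the common factors in \<open>a\<close> and
      \<open>b + 1 - k\<close> are removed: the two sides differ by twice the quadratic for
      \<open>b\<close>.\<close>
    have "6 * (b * (1 + b)) = (4 * b + 2) * (b + k)"
      using q by (simp add: algebra_simps)
    then show ?thesis by algebra
  qed
  have 2: "(4 * (a * (4 * (b + 1 - k)))\<^sup>2 - 8 / 3 * a\<^sup>2 * (4 * (b + 1 - k)) * (4 * b + 2)) * (b * (1 + b))
      = 8 / 3 * a\<^sup>2 * (4 * (b + 1 - k)) * (4 * b + 2) * (k * (1 - k))"
  proof -
    have "(6 * (b + 1 - k) - (4 * b + 2)) * (b * (1 + b)) = (4 * b + 2) * (k * (1 - k))"
      using q by algebra
    then show ?thesis by algebra
  qed
  show "16 * (2 * elliptic_K \<kappa> / L)\<^sup>2 * wave_speed L \<kappa> * (beta_sq \<kappa> * (1 + beta_sq \<kappa>))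
      = (eta4 L \<kappa>)\<^sup>2 * (beta_sq \<kappa> + \<kappa>\<^sup>2)"
    using 1 unfolding e c by (simp add: a_def b_def k_def)
  show "(4 * (wave_speed L \<kappa>)\<^sup>2 - (eta4 L \<kappa>)\<^sup>2) * (beta_sq \<kappa> * (1 + beta_sq \<kappa>))
      = (eta4 L \<kappa>)\<^sup>2 * (\<kappa>\<^sup>2 * (1 - \<kappa>\<^sup>2))"
    using 2 unfolding e c by (simp add: a_def b_def k_def)
qed

text \<open>Here \<open>a\<close> is the frequency, \<open>S\<close> a value of sn^2 and
  \<open>k\<close> the squared modulus. The chosen constant makes \<open>\<eta>\<close> a root, so
  with \<open>E = 4 * c\<^sup>2 - \<eta>\<^sup>2\<close> the quartic is
  \<open>y * (y - \<eta>) * (y\<^sup>2 + \<eta> * y - E) / (8 * c)\<close>. Substituting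
  \<open>y\<close> turns its factors into \<open>1 - k * S\<close>, \<open>S\<close> and
  \<open>1 - S\<close>, up to constants and powers of \<open>1 + b * S\<close>.\<close>

lemma quartic_energy_identity:
  fixes a b c k S y y' \<eta> :: real
  assumes c: "c \<noteq> 0" and b: "0 < b" and S: "0 \<le> S"
    and quad: "b\<^sup>2 + 2 * b - 2 * k * b - k = 0"
    and lead: "16 * a\<^sup>2 * c * (b * (1 + b)) = \<eta>\<^sup>2 * (b + k)"
    and roots: "(4 * c\<^sup>2 - \<eta>\<^sup>2) * (b * (1 + b)) = \<eta>\<^sup>2 * (k * (1 - k))"
    and y: "y = \<eta> * ((1 - k * S) / (1 + b * S))"
    and y': "y'\<^sup>2 = 4 * a\<^sup>2 * \<eta>\<^sup>2 * (b + k)\<^sup>2 * S * (1 - S) * (1 - k * S) / (1 + b * S) ^ 4"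
  shows "1 / 2 * y'\<^sup>2 + potential c (- (\<eta> / (8 * c)) * (4 * c\<^sup>2 - \<eta>\<^sup>2)) y = 0"
proof -
  define B where "B = 1 + b * S"
  define m where "m = b * (1 + b)"
  define E where "E = 4 * c\<^sup>2 - \<eta>\<^sup>2"
  have B: "B > 0" unfolding B_def using b S by (intro add_pos_nonneg) auto
  have m: "m > 0" unfolding m_def using b by simp
  have yB: "y * B = \<eta> * (1 - k * S)" using B by (simp add: y B_def)
  have "(y - \<eta>) * B = - (\<eta> * (b + k) * S)"
    using yB by (simp add: B_def algebra_simps)
  then have y1: "y - \<eta> = - (\<eta> * (b + k) * S) / B" using B by (simp add: field_simps)
  have "(y\<^sup>2 + \<eta> * y - E) * (B\<^sup>2 * m) = m * (y * B)\<^sup>2 + m * \<eta> * (y * B) * B - (E * m) * B\<^sup>2"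
    by (simp add: algebra_simps power2_eq_square)
  also have "\<dots> = \<eta>\<^sup>2 * (m * (1 - k * S)\<^sup>2 + m * (1 - k * S) * B - k * (1 - k) * B\<^sup>2)"
    using roots unfolding yB E_def[symmetric] m_def[symmetric] by algebra
  \<comment> \<open>The coefficient of S^2 on the left is a multiple of \<open>quad\<close> and
    vanishes: one root of the quadratic factor corresponds to infinite \<open>S\<close>, the other
    to \<open>S = 1\<close>.\<close>
  also have "m * (1 - k * S)\<^sup>2 + m * (1 - k * S) * B - k * (1 - k) * B\<^sup>2 = (1 - S) * (b + k)\<^sup>2"
    using quad unfolding m_def B_def by algebra
  finally have y2: "y\<^sup>2 + \<eta> * y - E = \<eta>\<^sup>2 * ((1 - S) * (b + k)\<^sup>2) / (B\<^sup>2 * m)"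
    using B m by (simp add: field_simps)
  have "potential c (- (\<eta> / (8 * c)) * E) y = y / (8 * c) * (y ^ 3 - 4 * c\<^sup>2 * y + \<eta> * E)"
    using c by (simp add: potential_def)
  also have "y ^ 3 - 4 * c\<^sup>2 * y + \<eta> * E = (y - \<eta>) * (y\<^sup>2 + \<eta> * y - E)"
    by (simp add: E_def algebra_simps power2_eq_square power3_eq_cube)
  also have "y / (8 * c) * \<dots>
      = - (\<eta>\<^sup>2 * (b + k)) / (c * m) * (\<eta>\<^sup>2 * (1 - k * S) * S * (1 - S) * (b + k)\<^sup>2 / (8 * B ^ 4))"
  proof -
    have "\<eta> * (X / B) / (8 * c) * (- (\<eta> * n * S) / B * (\<eta>\<^sup>2 * (Z * n\<^sup>2) / (B\<^sup>2 * m)))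
        = - (\<eta>\<^sup>2 * n) / (c * m) * (\<eta>\<^sup>2 * X * S * Z * n\<^sup>2 / (8 * B ^ 4))" for X Z n
      using B m c by (simp add: field_simps power2_eq_square power4_eq_xxxx)
    then show ?thesis unfolding y1 y2 unfolding y B_def .
  qed
  \<comment> \<open>The leading-coefficient relation cancels \<open>c\<close> and \<open>m\<close>,
    leaving minus half of the squared derivative.\<close>
  also have "\<eta>\<^sup>2 * (b + k) = 16 * a\<^sup>2 * (c * m)" using lead by (simp add: m_def)
  finally have "potential c (- (\<eta> / (8 * c)) * E) y
      = - 2 * a\<^sup>2 * (\<eta>\<^sup>2 * (1 - k * S) * S * (1 - S) * (b + k)\<^sup>2 / B ^ 4)"
    using c m by simp
  then show ?thesis
    unfolding y' B_def[symmetric] E_def[symmetric] by simp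
qed

lemma wave_speed_pos:
  assumes "L > 0" "0 < \<kappa>" "\<kappa> < 1"
  shows "0 < wave_speed L \<kappa>"
  using assms elliptic_K_pos[OF assms(2,3)] h_fun_pm_pos[of \<kappa>] by (simp add: wave_speed_def)

section \<open>Smoothness, periodicity and energy identity of the profile\<close>

context
  fixes L \<kappa> :: real
  assumes L: "L > 0" and \<kappa>: "0 < \<kappa>" "\<kappa> < 1"
begin

abbreviation (input) "freq \<equiv> 2 * elliptic_K \<kappa> / L"
abbreviation (input) "sn\<^sub>L \<xi> \<equiv> jacobi_sn (freq * \<xi>) \<kappa>"
abbreviation (input) "cn\<^sub>L \<xi> \<equiv> jacobi_cn (freq * \<xi>) \<kappa>"
abbreviation (input) "dn\<^sub>L \<xi> \<equiv> jacobi_dn (freq * \<xi>) \<kappa>"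
abbreviation (input) "den\<^sub>L \<xi> \<equiv> 1 + beta_sq \<kappa> * (sn\<^sub>L \<xi>)\<^sup>2"

lemma scaled_jacobi_has_deriv:
  shows "(sn\<^sub>L has_real_derivative freq * (cn\<^sub>L \<xi> * dn\<^sub>L \<xi>)) (at \<xi>)"
    and "(cn\<^sub>L has_real_derivative - freq * (sn\<^sub>L \<xi> * dn\<^sub>L \<xi>)) (at \<xi>)"
    and "(dn\<^sub>L has_real_derivative - freq * \<kappa>\<^sup>2 * (sn\<^sub>L \<xi> * cn\<^sub>L \<xi>)) (at \<xi>)"
proof -
  have chain: "((\<lambda>\<xi>. f (freq * \<xi>)) has_real_derivative d * freq) (at \<xi>)"
    if "(f has_real_derivative d) (at (freq * \<xi>))" for f d
    using that by (rule DERIV_chain2) (rule DERIV_cmult_Id)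
  show "(sn\<^sub>L has_real_derivative freq * (cn\<^sub>L \<xi> * dn\<^sub>L \<xi>)) (at \<xi>)"
    using chain[OF jacobi_sn_has_deriv[OF \<kappa>]] by (simp only: ac_simps)
  show "(cn\<^sub>L has_real_derivative - freq * (sn\<^sub>L \<xi> * dn\<^sub>L \<xi>)) (at \<xi>)"
    using chain[OF jacobi_cn_has_deriv[OF \<kappa>]] by (simp only: ac_simps mult_minus_left mult_minus_right)
  show "(dn\<^sub>L has_real_derivative - freq * \<kappa>\<^sup>2 * (sn\<^sub>L \<xi> * cn\<^sub>L \<xi>)) (at \<xi>)"
    using chain[OF jacobi_dn_has_deriv[OF \<kappa>]] by (simp only: ac_simps mult_minus_left mult_minus_right)
qed

lemma dnoidal_denominator_pos: "0 < den\<^sub>L \<xi>"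
  using beta_sq_pos[OF \<kappa>(1)] by (intro add_pos_nonneg) auto

text \<open>The derivative is written as a product of sn, cn, dn and the reciprocal denominator, so
  that it visibly lies in the algebra they generate.\<close>

lemma inverse_denominator_has_deriv:
  "((\<lambda>\<xi>. 1 / den\<^sub>L \<xi>) has_real_derivative
     - 2 * freq * beta_sq \<kappa> * (sn\<^sub>L \<xi> * (cn\<^sub>L \<xi> * (dn\<^sub>L \<xi> * ((1 / den\<^sub>L \<xi>) * (1 / den\<^sub>L \<xi>)))))) (at \<xi>)"
proof -
  have "(den\<^sub>L has_real_derivative
      0 + beta_sq \<kappa> * (real 2 * ((freq * (cn\<^sub>L \<xi> * dn\<^sub>L \<xi>)) * sn\<^sub>L \<xi> ^ (2 - Suc 0)))) (at \<xi>)"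
    by (intro DERIV_add DERIV_const DERIV_cmult DERIV_power scaled_jacobi_has_deriv)
  from DERIV_inverse'[OF this] show ?thesis
    using dnoidal_denominator_pos[of \<xi>] by (simp add: divide_inverse ac_simps)
qed

lemma dnoidal_profile_factors:
  "dnoidal_profile L \<kappa> = (\<lambda>\<xi>. eta4 L \<kappa> * ((dn\<^sub>L \<xi> * dn\<^sub>L \<xi>) * (1 / den\<^sub>L \<xi>)))"
  by (simp add: dnoidal_profile_def power2_eq_square fun_eq_iff)

lemma dnoidal_profile_smooth: "smooth_fun (dnoidal_profile L \<kappa>)"
proof -
  \<comment> \<open>Adjoining the reciprocal denominator as a fourth generator makes the profile a
    polynomial and keeps the algebra closed under differentiation.\<close>
  define G where "G = {sn\<^sub>L, cn\<^sub>L, dn\<^sub>L, \<lambda>\<xi>. 1 / den\<^sub>L \<xi>}"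
  have G: "sn\<^sub>L \<in> function_algebra G" "cn\<^sub>L \<in> function_algebra G" "dn\<^sub>L \<in> function_algebra G"
    "(\<lambda>\<xi>. 1 / den\<^sub>L \<xi>) \<in> function_algebra G"
    by (auto simp: G_def intro: function_algebra.gen)
  note alg = function_algebra.mult function_algebra.const G
  have "dnoidal_profile L \<kappa> \<in> function_algebra G"
    unfolding dnoidal_profile_factors by (intro alg)
  then show ?thesis
  proof (rule smooth_fun_function_algebra)
    fix g assume "g \<in> G"
    then consider "g = sn\<^sub>L" | "g = cn\<^sub>L" | "g = dn\<^sub>L" | "g = (\<lambda>\<xi>. 1 / den\<^sub>L \<xi>)"
      by (auto simp: G_def)
    then show "\<exists>g'\<in>function_algebra G. \<forall>x. (g has_real_derivative g' x) (at x)"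
    proof cases
      case 1
      show ?thesis unfolding 1
        by (rule bexI, rule allI, rule scaled_jacobi_has_deriv) (intro alg)
    next
      case 2
      show ?thesis unfolding 2
        by (rule bexI, rule allI, rule scaled_jacobi_has_deriv) (intro alg)
    next
      case 3
      show ?thesis unfolding 3
        by (rule bexI, rule allI, rule scaled_jacobi_has_deriv) (intro alg)
    next
      case 4
      show ?thesis unfolding 4
        by (rule bexI, rule allI, rule inverse_denominator_has_deriv) (intro alg)
    qed
  qed
qed

lemma dnoidal_profile_has_deriv:
  "(dnoidal_profile L \<kappa> has_real_derivative
     - 2 * freq * eta4 L \<kappa> * (beta_sq \<kappa> + \<kappa>\<^sup>2) * (sn\<^sub>L \<xi> * cn\<^sub>L \<xi> * dn\<^sub>L \<xi>) / (den\<^sub>L \<xi>)\<^sup>2) (at \<xi>)"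
proof -
  define s where "s = sn\<^sub>L \<xi>"
  define d where "d = dn\<^sub>L \<xi>"
  define B where "B = den\<^sub>L \<xi>"
  have B: "B > 0" unfolding B_def by (rule dnoidal_denominator_pos)
  have dd: "d * d = 1 - \<kappa>\<^sup>2 * s\<^sup>2"
    using jacobi_dn_sq[OF \<kappa>] by (simp add: d_def s_def power2_eq_square)
  \<comment> \<open>Since dn^2 is \<open>1 - \<kappa>\<^sup>2 * s\<^sup>2\<close>, the terms in
    \<open>s\<^sup>2\<close> cancel and the numerator factor from the quotient is constant.\<close>
  have num: "\<kappa>\<^sup>2 * B + beta_sq \<kappa> * (d * d) = beta_sq \<kappa> + \<kappa>\<^sup>2"
    unfolding dd unfolding B_def s_def by (simp add: algebra_simps)
  have "(dnoidal_profile L \<kappa> has_real_derivative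
     eta4 L \<kappa> * (((- freq * \<kappa>\<^sup>2 * (s * cn\<^sub>L \<xi>)) * d + (- freq * \<kappa>\<^sup>2 * (s * cn\<^sub>L \<xi>)) * d) * (1 / B)
       + (- 2 * freq * beta_sq \<kappa> * (s * (cn\<^sub>L \<xi> * (d * ((1 / B) * (1 / B)))))) * (d * d))) (at \<xi>)"
    unfolding dnoidal_profile_factors s_def d_def B_def
    by (intro DERIV_cmult DERIV_mult scaled_jacobi_has_deriv inverse_denominator_has_deriv)
  also have "eta4 L \<kappa> * (((- freq * \<kappa>\<^sup>2 * (s * cn\<^sub>L \<xi>)) * d + (- freq * \<kappa>\<^sup>2 * (s * cn\<^sub>L \<xi>)) * d) * (1 / B)
       + (- 2 * freq * beta_sq \<kappa> * (s * (cn\<^sub>L \<xi> * (d * ((1 / B) * (1 / B)))))) * (d * d))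
     = - 2 * freq * eta4 L \<kappa> * (\<kappa>\<^sup>2 * B + beta_sq \<kappa> * (d * d)) * (s * cn\<^sub>L \<xi> * d) / B\<^sup>2"
    using B L by (simp add: field_simps power2_eq_square)
  finally show ?thesis unfolding num unfolding s_def d_def B_def .
qed

lemma dnoidal_profile_periodic: "dnoidal_profile L \<kappa> (\<xi> + L) = dnoidal_profile L \<kappa> \<xi>"
proof -
  have "2 * elliptic_K \<kappa> * (\<xi> + L) / L = 2 * elliptic_K \<kappa> * \<xi> / L + 2 * elliptic_K \<kappa>"
    using L by (simp add: field_simps)
  then show ?thesis
    \<comment> \<open>With dn^2 expressed by sn^2, the profile depends on sn^2 alone, whose period
      is 2K.\<close>
    unfolding dnoidal_profile_def jacobi_dn_sq[OF \<kappa>] by (simp only: jacobi_sn_sq_plus_2K[OF \<kappa>])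
qed

lemma dnoidal_profile_energy:
  "1 / 2 * (deriv (dnoidal_profile L \<kappa>) \<xi>)\<^sup>2
     + potential (wave_speed L \<kappa>) (F1_const L \<kappa>) (dnoidal_profile L \<kappa> \<xi>) = 0"
  unfolding F1_const_def
proof (rule quartic_energy_identity)
  show "wave_speed L \<kappa> \<noteq> 0" using wave_speed_pos[OF L \<kappa>] by simp
  show "0 < beta_sq \<kappa>" by (rule beta_sq_pos[OF \<kappa>(1)])
  show "0 \<le> (sn\<^sub>L \<xi>)\<^sup>2" by simp
  show "(beta_sq \<kappa>)\<^sup>2 + 2 * beta_sq \<kappa> - 2 * \<kappa>\<^sup>2 * beta_sq \<kappa> - \<kappa>\<^sup>2 = 0"
    by (rule beta_sq_quadratic)
  show "16 * freq\<^sup>2 * wave_speed L \<kappa> * (beta_sq \<kappa> * (1 + beta_sq \<kappa>))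
      = (eta4 L \<kappa>)\<^sup>2 * (beta_sq \<kappa> + \<kappa>\<^sup>2)"
    by (rule eta4_wave_speed_relations)
  show "(4 * (wave_speed L \<kappa>)\<^sup>2 - (eta4 L \<kappa>)\<^sup>2) * (beta_sq \<kappa> * (1 + beta_sq \<kappa>))
      = (eta4 L \<kappa>)\<^sup>2 * (\<kappa>\<^sup>2 * (1 - \<kappa>\<^sup>2))"
    by (rule eta4_wave_speed_relations)
  show "dnoidal_profile L \<kappa> \<xi> = eta4 L \<kappa> * ((1 - \<kappa>\<^sup>2 * (sn\<^sub>L \<xi>)\<^sup>2) / den\<^sub>L \<xi>)"
    by (simp add: dnoidal_profile_def jacobi_dn_sq[OF \<kappa>])
  \<comment> \<open>Squaring leaves only even powers of cn and dn, so the squared derivative becomes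
    a rational function of sn^2.\<close>
  have "(deriv (dnoidal_profile L \<kappa>) \<xi>)\<^sup>2 = 4 * freq\<^sup>2 * (eta4 L \<kappa>)\<^sup>2 * (beta_sq \<kappa> + \<kappa>\<^sup>2)\<^sup>2
      * (sn\<^sub>L \<xi>)\<^sup>2 * (cn\<^sub>L \<xi>)\<^sup>2 * (dn\<^sub>L \<xi>)\<^sup>2 / ((den\<^sub>L \<xi>)\<^sup>2)\<^sup>2"
    unfolding DERIV_imp_deriv[OF dnoidal_profile_has_deriv]
    by (simp only: power_mult_distrib power_divide power2_minus mult.assoc) simp
  then show "(deriv (dnoidal_profile L \<kappa>) \<xi>)\<^sup>2 = 4 * freq\<^sup>2 * (eta4 L \<kappa>)\<^sup>2 * (beta_sq \<kappa> + \<kappa>\<^sup>2)\<^sup>2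
      * (sn\<^sub>L \<xi>)\<^sup>2 * (1 - (sn\<^sub>L \<xi>)\<^sup>2) * (1 - \<kappa>\<^sup>2 * (sn\<^sub>L \<xi>)\<^sup>2) / (den\<^sub>L \<xi>) ^ 4"
    unfolding jacobi_cn_sq[OF \<kappa>] jacobi_dn_sq[OF \<kappa>] by (simp flip: power_mult)
qed

lemma dnoidal_profile_zero: "dnoidal_profile L \<kappa> 0 = eta4 L \<kappa>"
  by (simp add: dnoidal_profile_def jacobi_dn_def jacobi_sn_def jacobi_am_zero[OF \<kappa>])

lemma dnoidal_periodic_profile:
  "periodic_profile L (wave_speed L \<kappa>) (F1_const L \<kappa>) (dnoidal_profile L \<kappa>)"
  unfolding periodic_profile_def
  using dnoidal_profile_smooth dnoidal_profile_periodic dnoidal_profile_energy by blast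

end

theorem proposition1:
  fixes L :: real
  assumes "L > 0"
  shows "(\<forall>c F\<^sub>1 :: real. \<forall>\<psi> :: real \<Rightarrow> real.
            c > 0 \<longrightarrow> periodic_profile L c F\<^sub>1 \<psi> \<longrightarrow>
            solves_system (\<lambda>x t. \<psi> (x - c * t)) (\<lambda>x t. (\<psi> (x - c * t))\<^sup>2 / (2 * c))) \<and>
         (\<forall>\<kappa> \<in> {0<..<1}.
            wave_speed L \<kappa> > 0 \<and>
            periodic_profile L (wave_speed L \<kappa>) (F1_const L \<kappa>) (dnoidal_profile L \<kappa>) \<and>
            dnoidal_profile L \<kappa> 0 = eta4 L \<kappa>)"
  using assms periodic_profile_solves_system wave_speed_pos dnoidal_periodic_profile
    dnoidal_profile_zero
  by (meson greaterThanLessThan_iff)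

end
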